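(* Let $T$ be a pr-tree (a plane rooted tree) and let $T'$ be a pr-tree obtained from $T$ by a level one permutation. Then $T'$ and $T$ have the same parity, i.e. $T'$ is even if and only if $T$ is even.
   Context: A pr-tree (plane rooted tree) is a finite tree embedded in the plane with a chosen root vertex and a chosen marked edge incident to the root; it is drawn growing downwards from the root with the marked edge as the leftmost edge at the root. Equivalently, it is a rooted tree in which the children of every vertex are linearly ordered from left to right. The root is the vertex of level 0, its children are the vertices of level 1, and so on. Each level 1 vertex is the root of a pr-subtree of $T$. A level one permutation is any change of the left-to-right order of the level 1 vertices together with the pr-subtrees rooted at them (the subtrees themselves being unchanged). Bracket code: walk around the tree starting at the root, visiting the children of each vertex from left to right (depth-first); write an opening bracket when a vertex is met for the first time and a closing bracket when it is met for the last time. Thus, recursively, the code of a pr-tree whose root has pr-subtrees $T_1,\dots,T_s$ (left to right) is $(\,c(T_1)\cdots c(T_s)\,)$, where $c(T_i)$ is the code of $T_i$, and the one-vertex tree has code $()$. An inversion in a bracket code is a pair consisting of a closing bracket and an opening bracket, not necessarily adjacent, such that the closing bracket occurs before the opening bracket. A pr-tree is even if the number of inversions in its bracket code is even, and odd otherwise; this is its parity. *)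

theory Defs
  imports "HOL-Combinatorics.Permutations"
begin

text \<open>Plane rooted trees: a vertex is given by the list of the subtrees rooted at its children,
  from left to right. A marked edge at the root amounts to a choice of the leftmost child
  there, so it is part of this order; \<^term>\<open>Node []\<close> is the one-vertex tree.\<close>

datatype pr_tree = Node (pr_subtrees: "pr_tree list")

datatype bracket = Opening | Closing

primrec bracket_code :: "pr_tree \<Rightarrow> bracket list" where
  "bracket_code (Node ts) = Opening # concat (map bracket_code ts) @ [Closing]"

text \<open>Inversions are pairs of positions, so equal brackets at different places are
  distinguished.\<close>

definition inversions :: "bracket list \<Rightarrow> (nat \<times> nat) set" where
  "inversions w = {(i, j). i < j \<and> j < length w \<and> w ! i = Closing \<and> w ! j = Opening}"

definition even_tree :: "pr_tree \<Rightarrow> bool" where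
  "even_tree T \<longleftrightarrow> even (card (inversions (bracket_code T)))"

text \<open>The trivial permutation is allowed.\<close>

definition level_one_permutation :: "pr_tree \<Rightarrow> pr_tree \<Rightarrow> bool" where
  "level_one_permutation T T' \<longleftrightarrow>
     (\<exists>p. p permutes {..<length (pr_subtrees T)} \<and>
          T' = Node (permute_list p (pr_subtrees T)))"

end

theory Submission
  imports Defs
begin

text \<open>A bracket code contains as many opening as closing brackets, say \<open>n\<close> of each. An inversion
  of a concatenation of such words lies inside one factor or straddles two of them, and the factors
  numbered \<open>i < j\<close> are straddled by \<open>n\<^sub>i n\<^sub>j\<close> inversions. The total is therefore symmetric in the
  factors, so a level one permutation preserves even the number of inversions.\<close>

lemma finite_inversions: "finite (inversions w)"
  by (rule finite_subset[of _ "{..<length w} \<times> {..<length w}"]) (auto simp: inversions_def)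

lemma card_inversions_Nil [simp]: "card (inversions []) = 0"
  by (simp add: inversions_def)

text \<open>Inversions are split by whether their left position is \<open>0\<close>, which requires
  \<open>x\<close> to be a closing bracket.\<close>

lemma inversions_Cons:
  "inversions (x # w) = map_prod Suc Suc ` inversions w \<union>
     (\<lambda>j. (0, Suc j)) ` {j. x = Closing \<and> j < length w \<and> w ! j = Opening}"
proof (rule set_eqI, clarify)
  fix i j
  show "(i, j) \<in> inversions (x # w) \<longleftrightarrow> (i, j) \<in> map_prod Suc Suc ` inversions w \<union>
     (\<lambda>j. (0, Suc j)) ` {j. x = Closing \<and> j < length w \<and> w ! j = Opening}"
    by (cases i; cases j) (auto simp: inversions_def image_iff)
qed

lemma card_inversions_Cons [simp]:
  "card (inversions (x # w)) =
     card (inversions w) + (if x = Closing then count_list w Opening else 0)"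
proof -
  let ?J = "{j. x = Closing \<and> j < length w \<and> w ! j = Opening}"
  have "card (inversions (x # w)) =
      card (map_prod Suc Suc ` inversions w) + card ((\<lambda>j. (0::nat, Suc j)) ` ?J)"
    unfolding inversions_Cons by (rule card_Un_disjoint) (auto simp: finite_inversions)
  also have "card (map_prod Suc Suc ` inversions w) = card (inversions w)"
    by (intro card_image inj_onI) auto
  also have "card ((\<lambda>j. (0::nat, Suc j)) ` ?J) = card ?J"
    by (intro card_image inj_onI) auto
  also have "card ?J = (if x = Closing then count_list w Opening else 0)"
    by (simp add: count_list_eq_length_filter length_filter_conv_card eq_commute)
  finally show ?thesis .
qed

text \<open>The product counts the straddling pairs: every closing bracket of \<open>u\<close>
  precedes every opening bracket of \<open>v\<close>.\<close>

lemma card_inversions_append [simp]: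
  "card (inversions (u @ v)) =
     card (inversions u) + card (inversions v) + count_list u Closing * count_list v Opening"
  by (induction u) auto

lemma count_list_concat:
  "count_list (concat ws) x = (\<Sum>w\<leftarrow>ws. count_list w x)"
  by (induction ws) auto

lemma count_list_bracket_code:
  "count_list (bracket_code t) Closing = count_list (bracket_code t) Opening"
  by (induction t) (simp add: count_list_concat cong: map_cong)

text \<open>The identity \<open>(\<Sum>n\<^sub>i)\<^sup>2 = \<Sum>n\<^sub>i\<^sup>2 + 2 \<Sum>\<^bsub>i<j\<^esub> n\<^sub>i n\<^sub>j\<close> expresses the straddling inversions
  by sums that do not depend on the order.\<close>

lemma card_inversions_concat:
  assumes "\<And>w. w \<in> set ws \<Longrightarrow> count_list w Closing = count_list w Opening"
  shows "2 * card (inversions (concat ws)) + (\<Sum>w\<leftarrow>ws. (count_list w Opening)\<^sup>2) =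
    2 * (\<Sum>w\<leftarrow>ws. card (inversions w)) + (\<Sum>w\<leftarrow>ws. count_list w Opening)\<^sup>2"
  using assms
  by (induction ws) (auto simp: count_list_concat power2_eq_square algebra_simps)

text \<open>In the preceding identity all terms but the first are built from sums over the factors,
  so they depend only on the multiset of factors.\<close>

lemma card_inversions_concat_mset_cong:
  assumes "mset ws = mset ws'"
    and "\<And>w. w \<in> set ws \<Longrightarrow> count_list w Closing = count_list w Opening"
  shows "card (inversions (concat ws)) = card (inversions (concat ws'))"
proof -
  have "sum_list (map f ws) = sum_list (map f ws')" for f :: "bracket list \<Rightarrow> nat"
    using assms(1) by (metis mset_map sum_mset_sum_list)
  moreover have "set ws = set ws'"
    using assms(1) by (rule mset_eq_setD)
  ultimately show ?thesis
    using card_inversions_concat[of ws] card_inversions_concat[of ws'] assms(2) by simp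
qed

theorem proposition2p1:
  fixes T T' :: pr_tree
  assumes "level_one_permutation T T'"
  shows "even_tree T' \<longleftrightarrow> even_tree T"
proof -
  obtain ts where T: "T = Node ts"
    by (cases T)
  with assms obtain p where p: "p permutes {..<length ts}" and T': "T' = Node (permute_list p ts)"
    by (auto simp: level_one_permutation_def)
  have "mset (map bracket_code (permute_list p ts)) = mset (map bracket_code ts)"
    using p by simp
  then have "card (inversions (concat (map bracket_code (permute_list p ts)))) =
      card (inversions (concat (map bracket_code ts)))"
    by (rule card_inversions_concat_mset_cong) (auto simp: count_list_bracket_code)
  \<comment> \<open>The root's outer brackets add no inversion: the opening one comes first and the
    closing one last.\<close>
  then show ?thesis
    by (simp add: T T' even_tree_def)
qed

end
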